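(* Let $\phi$ be a nonconstant function in $H^\infty(\overline{\mathbb{D}})$. Then $G(\phi)$ (with composition of maps) is a finite cyclic group.
   Context: $\mathbb{D}$ is the open unit disk in $\mathbb{C}$ and $\mathbb{T}$ its boundary. $H^\infty(\overline{\mathbb{D}})$ is the set of functions that are holomorphic on (a neighborhood of) $\overline{\mathbb{D}}$. $G(\phi)$ is the set of all continuous maps $\rho:\mathbb{T}\to\mathbb{T}$ satisfying $\phi(\rho(z))=\phi(z)$ for all $z\in\mathbb{T}$; a priori it is a semigroup under composition. *)

theory Defs
  imports "HOL-Analysis.Analysis" "HOL-Algebra.Elementary_Groups"
begin

text \<open>
  Maps from the unit circle to itself are represented by extensional functions (with value
  \<^const>\<open>undefined\<close> off the circle), so that equality in HOL is equality of maps on the circle.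
  The product is composition, in the order of function application.
\<close>

definition G_phi :: "(complex \<Rightarrow> complex) \<Rightarrow> (complex \<Rightarrow> complex) monoid" where
  "G_phi \<phi> =
    \<lparr>carrier = {\<rho> \<in> sphere 0 1 \<rightarrow>\<^sub>E sphere 0 1.
                 continuous_on (sphere 0 1) \<rho> \<and> (\<forall>z\<in>sphere 0 1. \<phi> (\<rho> z) = \<phi> z)},
     mult = (\<lambda>\<rho> \<sigma>. compose (sphere 0 1) \<rho> \<sigma>),
     one = (\<lambda>z\<in>sphere 0 1. z)\<rparr>"

lemma monoid_G_phi: "monoid (G_phi \<phi>)"
proof (rule monoidI)
  fix x y assume xy: "x \<in> carrier (G_phi \<phi>)" "y \<in> carrier (G_phi \<phi>)"
  then have im: "y ` sphere 0 1 \<subseteq> sphere 0 1" and cx: "continuous_on (sphere 0 1) x"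
    and cy: "continuous_on (sphere 0 1) y"
    by (auto simp: G_phi_def PiE_iff)
  have "continuous_on (sphere 0 1) (\<lambda>z. x (y z))"
    by (rule continuous_on_compose2[OF cx cy im])
  then have "continuous_on (sphere 0 1) (compose (sphere 0 1) x y)"
    by (rule continuous_on_eq) (simp add: compose_def)
  moreover have "compose (sphere 0 1) x y \<in> sphere 0 1 \<rightarrow>\<^sub>E sphere 0 1"
    using xy by (simp add: G_phi_def PiE_iff compose_def)
  moreover have "\<forall>z\<in>sphere 0 1. \<phi> (compose (sphere 0 1) x y z) = \<phi> z"
    using xy by (simp add: G_phi_def PiE_iff compose_def)
  ultimately show "x \<otimes>\<^bsub>G_phi \<phi>\<^esub> y \<in> carrier (G_phi \<phi>)"
    by (simp add: G_phi_def)
next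
  have "continuous_on (sphere 0 1) (\<lambda>z\<in>sphere 0 1. z :: complex)"
    by (rule continuous_on_eq[OF continuous_on_id]) simp
  then show "\<one>\<^bsub>G_phi \<phi>\<^esub> \<in> carrier (G_phi \<phi>)"
    by (simp add: G_phi_def)
qed (auto simp: G_phi_def PiE_iff compose_def fun_eq_iff extensional_def)

end

theory Submission
  imports Defs "HOL-Complex_Analysis.Complex_Analysis"
begin

text \<open>
  The proof works on the universal cover of the circle. Let \<open>circ t = exp (2 \<pi> \<i> t)\<close> and
  \<open>f t = \<phi> (circ t)\<close>; this is a function of period 1 on the line whose fibres are finite on a
  period, by the identity theorem. A map \<open>\<rho>\<close> in the semigroup lifts to a continuous \<open>\<theta>\<close> with
  \<open>f \<circ> \<theta> = f\<close> and \<open>\<theta> (t + 1) = \<theta> t + d\<close>, where the integer \<open>d\<close> is the degree of \<open>\<rho>\<close>.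

  That \<open>\<phi>\<close> is holomorphic in the whole disc, and not only near the circle, forces \<open>d = 1\<close>
  (\<open>fibre_preserving_lift_add_1\<close>). The set \<open>\<phi> (disc)\<close> is open and \<open>\<phi> (circle)\<close> is a null set, so
  there is a point \<open>w\<close> in the former and not in the latter; by the argument principle the curve \<open>f\<close>
  winds around \<open>w\<close> a positive number \<open>n\<close> of times. A continuous logarithm \<open>L\<close> of \<open>f - w\<close> thus
  grows by \<open>2 \<pi> \<i> n\<close> per period, while \<open>L \<circ> \<theta> - L\<close> is constant since \<open>f \<circ> \<theta> = f\<close>. Comparing the
  growth of both terms over one period yields \<open>n d = n\<close>.

  Everything else is about the set of continuous \<open>\<theta>\<close> with \<open>f \<circ> \<theta> = f\<close> and \<open>\<theta> (t + 1) = \<theta> t + 1\<close>.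
  Such a \<open>\<theta>\<close> is onto by the intermediate value theorem, so it induces a surjection, hence a
  bijection, of each finite fibre modulo 1; therefore \<open>\<theta>\<close> is injective and an increasing
  homeomorphism. If it has a fixed point, it is the identity, because an increasing bijection of a
  finite ordered set is trivial. As for a discrete group of translations, the \<open>\<tau>\<close> with least
  positive value at 0 then generates all of them (\<open>deck_lifts_cyclic\<close>). In particular the unit shift,
  which descends to the identity of the circle, is a power \<open>\<tau>\<^sup>N\<close>. So the map of the circle
  induced by \<open>\<tau>\<close> has finite order and its powers exhaust the semigroup.
\<close>

section \<open>Lifts that preserve the fibres of a periodic function\<close>

lemma periodic_add_of_int:
  fixes g :: "real \<Rightarrow> 'a"
  assumes "\<And>t. g (t + 1) = g t"
  shows "g (t + of_int k) = g t"
proof (induction k arbitrary: t rule: int_induct[where k = 0])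
  case (step1 i)
  show ?case
    using step1(2)[of t] assms[of "t + of_int i"] by (simp add: add_ac)
next
  case (step2 i)
  show ?case
    using step2(2)[of t] assms[of "t + of_int (i - 1)"] by (simp add: add_ac)
qed simp

locale finite_fibre_periodic =
  fixes f :: "real \<Rightarrow> 'a"
  assumes periodic: "f (t + 1) = f t"
    and finite_fibre: "finite {t \<in> {0..<1}. f t = c}"
begin

text \<open>
  If \<open>f\<close> is the pull-back of a function on the circle, these are the lifts to the line of the
  degree-one self-maps of the circle that preserve its fibres.
\<close>

definition deck_lifts :: "(real \<Rightarrow> real) set" where
  "deck_lifts = {\<theta>. continuous_on UNIV \<theta> \<and> (\<forall>t. f (\<theta> t) = f t) \<and> (\<forall>t. \<theta> (t + 1) = \<theta> t + 1)}"

lemma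
  assumes "\<theta> \<in> deck_lifts"
  shows deck_lift_continuous: "continuous_on UNIV \<theta>"
    and deck_lift_fibre: "f (\<theta> t) = f t"
    and deck_lift_add_of_int: "\<theta> (t + of_int k) = \<theta> t + of_int k"
proof -
  have "\<theta> (t + of_int k) - (t + of_int k) = \<theta> t - t"
    by (rule periodic_add_of_int) (use assms in \<open>simp add: deck_lifts_def\<close>)
  then show "\<theta> (t + of_int k) = \<theta> t + of_int k"
    by simp
qed (use assms in \<open>auto simp: deck_lifts_def\<close>)

lemma finite_fibre_interval: "finite {t \<in> {a..b}. f t = c}"
proof (rule finite_subset)
  show "{t \<in> {a..b}. f t = c} \<subseteq>
    (\<lambda>(k, t). t + of_int k) ` ({\<lfloor>a\<rfloor>..\<lfloor>b\<rfloor>} \<times> {t \<in> {0..<1}. f t = c})"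
  proof
    fix t assume t: "t \<in> {t \<in> {a..b}. f t = c}"
    have "f (frac t) = f t"
      using periodic_add_of_int[of f, OF periodic, of "frac t" "\<lfloor>t\<rfloor>"] by (simp add: frac_def)
    with t have "(\<lfloor>t\<rfloor>, frac t) \<in> {\<lfloor>a\<rfloor>..\<lfloor>b\<rfloor>} \<times> {t \<in> {0..<1}. f t = c}"
      by (auto simp: frac_lt_1 floor_mono)
    moreover have "t = frac t + of_int \<lfloor>t\<rfloor>"
      by (simp add: frac_def)
    ultimately show "t \<in> (\<lambda>(k, t). t + of_int k) ` ({\<lfloor>a\<rfloor>..\<lfloor>b\<rfloor>} \<times> {t \<in> {0..<1}. f t = c})"
      by (intro image_eqI[where x = "(\<lfloor>t\<rfloor>, frac t)"]) auto
  qed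
qed (use finite_fibre in auto)

lemma deck_lift_surj:
  assumes "\<theta> \<in> deck_lifts"
  shows "surj \<theta>"
proof -
  have "\<exists>s. \<theta> s = y" for y
  proof -
    define k where "k = \<lfloor>y - \<theta> 0\<rfloor>"
    have "\<theta> (of_int k) = \<theta> 0 + of_int k" "\<theta> (of_int (k + 1)) = \<theta> 0 + of_int (k + 1)"
      using deck_lift_add_of_int[OF assms, of 0] by (simp_all del: of_int_add)
    then have "\<theta> (of_int k) \<le> y" "y \<le> \<theta> (of_int (k + 1))"
      unfolding k_def by linarith+
    then have "\<exists>s\<ge>of_int k. s \<le> of_int (k + 1) \<and> \<theta> s = y"
      by (intro IVT' continuous_on_subset[OF deck_lift_continuous[OF assms]]) auto
    then show ?thesis by blast
  qed
  then show ?thesis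
    by (metis surjI)
qed

text \<open>
  A lift acts on each fibre modulo 1, where it is a surjective self-map of a finite set and hence
  injective. Two points with the same image therefore differ by an integer, and this integer is 0
  because the lift commutes with integer translations.
\<close>

lemma deck_lift_inj:
  assumes "\<theta> \<in> deck_lifts"
  shows "inj \<theta>"
proof (rule injI)
  fix s t assume st: "\<theta> s = \<theta> t"
  define A where "A = {u \<in> {0..<1}. f u = f s}"
  define h where "h = (\<lambda>u. frac (\<theta> u))"
  have f_frac: "f (frac u) = f u" for u
    using periodic_add_of_int[of f, OF periodic, of "frac u" "\<lfloor>u\<rfloor>"] by (simp add: frac_def)
  have h_frac: "h (frac u) = h u" for u
    using deck_lift_add_of_int[OF assms, of u "- \<lfloor>u\<rfloor>"]
    by (simp add: h_def frac_def)
  have "A \<subseteq> h ` A"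
  proof
    fix y assume y: "y \<in> A"
    obtain u where u: "\<theta> u = y"
      using deck_lift_surj[OF assms] by (metis surjD)
    have "f u = f y"
      using deck_lift_fibre[OF assms, of u] u by simp
    with y have "frac u \<in> A"
      by (auto simp: A_def f_frac frac_lt_1)
    moreover have "h (frac u) = y"
      using y u by (simp add: h_frac) (simp add: h_def A_def frac_eq)
    ultimately show "y \<in> h ` A" by blast
  qed
  then have "inj_on h A"
    using finite_fibre by (auto simp: A_def intro: finite_surj_inj)
  moreover have "f t = f s"
    using deck_lift_fibre[OF assms] st by metis
  then have "frac s \<in> A" "frac t \<in> A"
    by (auto simp: A_def f_frac frac_lt_1)
  moreover have "h (frac s) = h (frac t)"
    by (simp add: h_frac) (simp add: h_def st)
  ultimately have "frac s = frac t"
    by (auto dest: inj_onD)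
  then have "s = t + of_int (\<lfloor>s\<rfloor> - \<lfloor>t\<rfloor>)"
    by (simp add: frac_def)
  then have "\<theta> s = \<theta> t + of_int (\<lfloor>s\<rfloor> - \<lfloor>t\<rfloor>)"
    using deck_lift_add_of_int[OF assms] by metis
  with st \<open>s = _\<close> show "s = t" by simp
qed

text \<open>
  A continuous injection of the line is monotone; the sign is decided by a point \<open>b\<close> that is an
  integer translate of \<open>s\<close> beyond \<open>t\<close>.
\<close>

lemma deck_lift_strict_mono:
  assumes "\<theta> \<in> deck_lifts"
  shows "strict_mono \<theta>"
proof (rule strict_monoI)
  fix s t :: real assume "s < t"
  define b where "b = s + of_int (\<lfloor>t - s\<rfloor> + 1)"
  have "t < b"
    unfolding b_def by linarith
  then have "\<theta> s < \<theta> b"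
    using deck_lift_add_of_int[OF assms, of s "\<lfloor>t - s\<rfloor> + 1"] \<open>s < t\<close> by (simp add: b_def)
  moreover have "\<theta> s < \<theta> t \<and> \<theta> t < \<theta> b \<or> \<theta> b < \<theta> t \<and> \<theta> t < \<theta> s"
    using \<open>s < t\<close> \<open>t < b\<close> deck_lift_continuous[OF assms] deck_lift_inj[OF assms]
    by (intro continuous_inj_imp_mono) (auto intro: continuous_on_subset inj_on_subset)
  ultimately show "\<theta> s < \<theta> t" by linarith
qed

lemma deck_lift_shift: "(\<lambda>t. t + of_int k) \<in> deck_lifts"
  using periodic_add_of_int[of f, OF periodic] by (auto simp: deck_lifts_def intro!: continuous_intros)

lemma deck_lift_comp:
  assumes "\<theta> \<in> deck_lifts" "\<eta> \<in> deck_lifts"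
  shows "\<theta> \<circ> \<eta> \<in> deck_lifts"
  using assms unfolding deck_lifts_def
  by (auto intro: continuous_on_compose2[of UNIV])

lemma deck_lift_inv:
  assumes "\<theta> \<in> deck_lifts"
  shows "inv_into UNIV \<theta> \<in> deck_lifts"
proof -
  note [simp] = surj_f_inv_f[OF deck_lift_surj[OF assms]] inv_f_f[OF deck_lift_inj[OF assms]]
  have "mono (inv_into UNIV \<theta>)"
  proof (rule monoI)
    fix x y :: real assume "x \<le> y"
    then have "\<theta> (inv_into UNIV \<theta> x) \<le> \<theta> (inv_into UNIV \<theta> y)" by simp
    then show "inv_into UNIV \<theta> x \<le> inv_into UNIV \<theta> y"
      using strict_mono_less_eq[OF deck_lift_strict_mono[OF assms]] by blast
  qed
  moreover have "range (inv_into UNIV \<theta>) = UNIV"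
    by (metis deck_lift_inj[OF assms] inj_imp_surj_inv)
  ultimately have "continuous_on UNIV (inv_into UNIV \<theta>)"
    by (intro continuous_onI_mono) (auto dest: monoD)
  moreover have "f (inv_into UNIV \<theta> t) = f t" for t
    using deck_lift_fibre[OF assms, of "inv_into UNIV \<theta> t"] by simp
  moreover have "inv_into UNIV \<theta> (t + 1) = inv_into UNIV \<theta> t + 1" for t
  proof (rule injD[OF deck_lift_inj[OF assms]])
    show "\<theta> (inv_into UNIV \<theta> (t + 1)) = \<theta> (inv_into UNIV \<theta> t + 1)"
      using deck_lift_add_of_int[OF assms, of "inv_into UNIV \<theta> t" 1] by simp
  qed
  ultimately show ?thesis
    by (simp add: deck_lifts_def)
qed

text \<open>
  Fixed points are invariant under integer translations, so there is one, \<open>b\<close>, to the right of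
  \<open>t\<close>. Suppose that \<open>t\<close> moves to the right. Among the finitely many points of its fibre between \<open>t\<close>
  and \<open>b\<close>, take the last one, \<open>m\<close>, that moves to the right. Then \<open>\<theta> m > m\<close> also moves to the
  right, contrary to the choice of \<open>m\<close>.
\<close>

lemma deck_lift_fixpoint_le:
  assumes \<theta>: "\<theta> \<in> deck_lifts" and a: "\<theta> a = a"
  shows "\<theta> t \<le> t"
proof (rule ccontr)
  assume "\<not> \<theta> t \<le> t"
  define b where "b = a + of_int \<lceil>t - a\<rceil>"
  have b: "t \<le> b" "\<theta> b = b"
    using deck_lift_add_of_int[OF \<theta>, of a] a unfolding b_def by (linarith, simp)
  define M where "M = {s \<in> {t..b}. f s = f t \<and> s < \<theta> s}"
  have "finite M"
    by (rule finite_subset[OF _ finite_fibre_interval[of t b "f t"]]) (auto simp: M_def)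
  moreover have "t \<in> M"
    using \<open>\<not> \<theta> t \<le> t\<close> b by (simp add: M_def)
  ultimately have m: "Max M \<in> M" and max: "\<And>s. s \<in> M \<Longrightarrow> s \<le> Max M"
    by (auto intro: Max_in)
  note mono = strict_mono_less[OF deck_lift_strict_mono[OF \<theta>]]
    and mono_le = strict_mono_less_eq[OF deck_lift_strict_mono[OF \<theta>]]
  \<comment> \<open>The image does not pass \<open>b\<close>, since \<open>\<theta>\<close> is increasing and fixes \<open>b\<close>.\<close>
  have "\<theta> (Max M) \<in> M"
    using m b mono[of "Max M" "\<theta> (Max M)"] mono_le[of "Max M" b]
    by (auto simp: M_def deck_lift_fibre[OF \<theta>])
  then show False
    using max m by (fastforce simp: M_def)
qed

text \<open>
  Lifts act freely. The reverse inequality comes from the inverse lift, which has the same fixed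
  point.
\<close>

lemma deck_lift_fixpoint_imp_id:
  assumes \<theta>: "\<theta> \<in> deck_lifts" and a: "\<theta> a = a"
  shows "\<theta> = id"
proof
  fix t
  have "inv_into UNIV \<theta> a = a"
    using a inv_f_f[OF deck_lift_inj[OF \<theta>], of a] by simp
  then have "inv_into UNIV \<theta> (\<theta> t) \<le> \<theta> t"
    by (rule deck_lift_fixpoint_le[OF deck_lift_inv[OF \<theta>]])
  then show "\<theta> t = id t"
    using deck_lift_fixpoint_le[OF \<theta> a, of t] inv_f_f[OF deck_lift_inj[OF \<theta>], of t] by simp
qed

text \<open>
  Division with remainder: as long as \<open>\<sigma> 0 > 0\<close>, minimality of \<open>\<tau>\<close> permits replacing \<open>\<sigma>\<close> by
  \<open>inverse \<tau> \<circ> \<sigma>\<close> with value at 0 still nonnegative but smaller. The descent stops because it takes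
  place in a finite part of the fibre of 0, and a lift that fixes 0 is the identity.
\<close>

lemma deck_lift_eq_power:
  assumes \<tau>: "\<tau> \<in> deck_lifts" "0 < \<tau> 0"
    and least: "\<And>\<sigma>. \<sigma> \<in> deck_lifts \<Longrightarrow> 0 < \<sigma> 0 \<Longrightarrow> \<tau> 0 \<le> \<sigma> 0"
    and \<sigma>: "\<sigma> \<in> deck_lifts" "0 \<le> \<sigma> 0"
  shows "\<exists>k. \<sigma> = \<tau> ^^ k"
  using \<sigma>
proof (induction "card {t \<in> {0..<\<sigma> 0}. f t = f 0}" arbitrary: \<sigma> rule: less_induct)
  case less
  show ?case
  proof (cases "\<sigma> 0 = 0")
    case True
    then have "\<sigma> = \<tau> ^^ 0"
      using deck_lift_fixpoint_imp_id[OF less.prems(1)] by (simp add: fun_eq_iff)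
    then show ?thesis ..
  next
    case False
    define \<upsilon> where "\<upsilon> = inv_into UNIV \<tau> \<circ> \<sigma>"
    have \<upsilon>: "\<upsilon> \<in> deck_lifts"
      unfolding \<upsilon>_def by (intro deck_lift_comp deck_lift_inv \<tau> less.prems)
    have \<tau>\<upsilon>: "\<tau> (\<upsilon> t) = \<sigma> t" for t
      by (simp add: \<upsilon>_def surj_f_inv_f[OF deck_lift_surj[OF \<tau>(1)]])
    note mono = strict_mono_less_eq[OF deck_lift_strict_mono[OF \<tau>(1)]]
    have "\<tau> 0 \<le> \<sigma> 0"
      using least less.prems False by auto
    then have nonneg: "0 \<le> \<upsilon> 0"
      using mono[of 0 "\<upsilon> 0"] \<tau>\<upsilon>[of 0] by simp
    have lt: "\<upsilon> 0 < \<sigma> 0"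
    proof (rule ccontr)
      \<comment> \<open>Here \<open>\<tau>\<close> moves 0 to the right and \<open>\<upsilon> 0\<close> not to the right, so it has a fixed point.\<close>
      assume "\<not> \<upsilon> 0 < \<sigma> 0"
      then have "\<exists>s\<ge>0. s \<le> \<upsilon> 0 \<and> s - \<tau> s = 0"
        using nonneg \<tau>(2) \<tau>\<upsilon>[of 0]
        by (intro IVT') (auto intro!: continuous_intros continuous_on_subset[OF deck_lift_continuous[OF \<tau>(1)]])
      then have "\<tau> = id"
        using deck_lift_fixpoint_imp_id[OF \<tau>(1)] by (metis right_minus_eq)
      then show False using \<tau>(2) by simp
    qed
    have "{t \<in> {0..<\<upsilon> 0}. f t = f 0} \<subset> {t \<in> {0..<\<sigma> 0}. f t = f 0}"
      using lt nonneg deck_lift_fibre[OF \<upsilon>, of 0] by (intro psubsetI) auto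
    then have "card {t \<in> {0..<\<upsilon> 0}. f t = f 0} < card {t \<in> {0..<\<sigma> 0}. f t = f 0}"
      by (intro psubset_card_mono finite_subset[OF _ finite_fibre_interval[of 0 "\<sigma> 0" "f 0"]]) auto
    then obtain k where "\<upsilon> = \<tau> ^^ k"
      using less.hyps \<upsilon> nonneg by blast
    then have "\<sigma> = \<tau> ^^ Suc k"
      using \<tau>\<upsilon> by (auto simp: fun_eq_iff)
    then show ?thesis ..
  qed
qed

text \<open>
  Values at 0 of lifts lie in the fibre of 0, and the unit shift provides one in \<open>(0, 1]\<close>; so
  a least positive value exists. Lifts with negative value at 0 are inverses of powers; only
  nonnegative values are considered, as every lift has such a translate by an integer.
\<close>

theorem deck_lifts_cyclic:
  obtains \<tau> where "\<tau> \<in> deck_lifts" "\<And>\<sigma>. \<sigma> \<in> deck_lifts \<Longrightarrow> 0 \<le> \<sigma> 0 \<Longrightarrow> \<exists>k. \<sigma> = \<tau> ^^ k"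
proof -
  define P where "P = {t. 0 < t \<and> t \<le> 1 \<and> (\<exists>\<sigma>\<in>deck_lifts. \<sigma> 0 = t)}"
  have "P \<subseteq> {t \<in> {0..1}. f t = f 0}"
    unfolding P_def using deck_lift_fibre by fastforce
  then have fin: "finite P"
    using finite_fibre_interval finite_subset by blast
  have "(1::real) \<in> P"
    using bexI[OF _ deck_lift_shift[of 1], of "\<lambda>\<theta>. \<theta> 0 = 1"] by (simp add: P_def)
  then have "Min P \<in> P"
    using fin Min_in by blast
  then obtain \<tau> where \<tau>: "\<tau> \<in> deck_lifts" "\<tau> 0 = Min P" "0 < \<tau> 0" "\<tau> 0 \<le> 1"
    by (auto simp: P_def)
  have "\<tau> 0 \<le> \<sigma> 0" if "\<sigma> \<in> deck_lifts" "0 < \<sigma> 0" for \<sigma>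
  proof (cases "\<sigma> 0 \<le> 1")
    case True
    then show ?thesis
      using that fin \<tau>(2) by (auto intro!: Min_le simp: P_def)
  qed (use \<tau> in auto)
  then have "\<exists>k. \<sigma> = \<tau> ^^ k" if "\<sigma> \<in> deck_lifts" "0 \<le> \<sigma> 0" for \<sigma>
    using deck_lift_eq_power \<tau> that by blast
  then show ?thesis
    using that \<tau>(1) by blast
qed

end

section \<open>Self-maps of the circle and their lifts\<close>

lemma continuous_Ints_imp_constant:
  fixes g :: "real \<Rightarrow> 'a::real_normed_algebra_1"
  assumes "continuous_on UNIV g" "\<And>t. g t \<in> \<int>"
  shows "g s = g t"
proof -
  have "g constant_on UNIV"
  proof (rule continuous_discrete_range_constant[OF connected_UNIV assms(1)])
    fix x :: real
    have "1 \<le> norm (g y - g x)" if "g y \<noteq> g x" for y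
    proof -
      obtain k where k: "g y - g x = of_int k"
        using assms(2) Ints_diff Ints_cases by metis
      with that have "k \<noteq> 0" by auto
      then show ?thesis by (simp add: k)
    qed
    then show "\<exists>e>0. \<forall>y. y \<in> UNIV \<and> g y \<noteq> g x \<longrightarrow> e \<le> norm (g y - g x)"
      by (intro exI[of _ 1]) auto
  qed
  then show ?thesis
    by (auto simp: constant_on_def)
qed

definition circ :: "real \<Rightarrow> complex" where
  "circ t = cis (2 * pi * t)"

lemma circ_eq_iff: "circ s = circ t \<longleftrightarrow> s - t \<in> \<int>"
proof -
  have "circ s = circ t \<longleftrightarrow> (\<exists>n::int. 2 * pi * s = 2 * pi * t + 2 * pi * n)"
    unfolding sin_cos_eq_iff[symmetric] by (auto simp: circ_def complex_eq_iff)
  also have "\<dots> \<longleftrightarrow> (\<exists>n::int. s = t + n)"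
    by (intro ex_cong1) (simp flip: distrib_left)
  also have "\<dots> \<longleftrightarrow> s - t \<in> \<int>"
    by (auto simp: Ints_def algebra_simps)
  finally show ?thesis .
qed

lemma circ_add: "circ (s + t) = circ s * circ t"
  by (simp add: circ_def cis_mult distrib_left)

lemma circ_add_1 [simp]: "circ (t + 1) = circ t"
  by (simp add: circ_eq_iff)

lemma norm_circ [simp]: "norm (circ t) = 1"
  by (simp add: circ_def)

lemma continuous_on_circ [continuous_intros]:
  "continuous_on A g \<Longrightarrow> continuous_on A (\<lambda>x. circ (g x))"
  unfolding circ_def cis_conv_exp by (intro continuous_intros)

lemma isCont_circ: "isCont circ t"
  using continuous_on_circ[OF continuous_on_id, of UNIV] by (simp add: continuous_on_eq_continuous_at)

lemma circ_Arg: "norm z = 1 \<Longrightarrow> circ (Arg z / (2 * pi)) = z"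
  using cis_Arg[of z] by (cases "z = 0") (auto simp: circ_def sgn_eq)

lemma circlepath_eq_circ: "circlepath 0 1 = circ"
  by (auto simp: circlepath circ_def cis_conv_exp mult_ac)

lemma circ_continuous_lift:
  fixes g :: "real \<Rightarrow> complex"
  assumes "continuous_on UNIV g" "\<And>t. norm (g t) = 1"
  obtains \<theta> where "continuous_on UNIV \<theta>" "\<And>t. g t = circ (\<theta> t)"
proof -
  have "g t \<noteq> 0" for t
    using assms(2)[of t] by auto
  then obtain h where h: "continuous_on UNIV h" "\<And>t. g t = exp (h t)"
    using continuous_logarithm_on_contractible[OF assms(1)] by auto
  show ?thesis
  proof
    show "continuous_on UNIV (\<lambda>t. Im (h t) / (2 * pi))"
      by (intro continuous_intros h) auto
    show "g t = circ (Im (h t) / (2 * pi))" for t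
      using assms(2)[of t] by (simp add: h(2) circ_def exp_eq_polar norm_mult)
  qed
qed

text \<open>
  The self-map of the circle with lift \<open>\<theta>\<close>. It is extensional, so that it can belong to the carrier
  of \<open>G_phi\<close>. The choice of \<open>Arg z / (2 \<pi>)\<close> among the preimages of \<open>z\<close> is immaterial as soon as
  \<open>\<theta>\<close> commutes with integer translations.
\<close>

definition circle_map :: "(real \<Rightarrow> real) \<Rightarrow> complex \<Rightarrow> complex" where
  "circle_map \<theta> = (\<lambda>z\<in>sphere 0 1. circ (\<theta> (Arg z / (2 * pi))))"

lemma circle_map_circ:
  assumes "\<And>s k. \<theta> (s + of_int k) = \<theta> s + of_int k"
  shows "circle_map \<theta> (circ t) = circ (\<theta> t)"
proof -
  have "circ (Arg (circ t) / (2 * pi)) = circ t"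
    by (simp add: circ_Arg)
  then obtain k where "Arg (circ t) / (2 * pi) - t = of_int k"
    by (auto simp: circ_eq_iff elim: Ints_cases)
  then have "Arg (circ t) / (2 * pi) = t + of_int k"
    by (simp add: algebra_simps)
  then show ?thesis
    by (simp add: circle_map_def assms circ_eq_iff)
qed

text \<open>
  The principal argument jumps at \<open>-1\<close>. Near a given point \<open>z0\<close> the preimage
  \<open>t0 + Arg (z / z0) / (2 \<pi>)\<close> is used instead: it yields the same map of the circle, and it is
  continuous at \<open>z0\<close> because the argument is continuous at 1.
\<close>

lemma continuous_on_circle_map:
  assumes cont: "continuous_on UNIV \<theta>" and per: "\<And>s k. \<theta> (s + of_int k) = \<theta> s + of_int k"
  shows "continuous_on (sphere 0 1) (circle_map \<theta>)"
proof (rule continuous_on_eq_continuous_within[THEN iffD2], rule ballI)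
  fix z0 :: complex assume "z0 \<in> sphere 0 1"
  then have z0: "norm z0 = 1" by simp
  then have "z0 \<noteq> 0" by auto
  define t0 where "t0 = Arg z0 / (2 * pi)"
  have cont': "isCont \<theta> t" for t
    using cont by (simp add: continuous_on_eq_continuous_at)
  have eq: "circle_map \<theta> z = circ (\<theta> (t0 + Arg (z / z0) / (2 * pi)))" if "norm z = 1" for z
  proof -
    have "circ (t0 + Arg (z / z0) / (2 * pi)) = z"
      using that z0 \<open>z0 \<noteq> 0\<close> by (simp add: circ_add circ_Arg t0_def norm_divide)
    then show ?thesis
      using circle_map_circ[of \<theta>, OF per] by metis
  qed
  have "isCont (\<lambda>z. z / z0) z0"
    using \<open>z0 \<noteq> 0\<close> by (intro continuous_intros)
  moreover have "isCont Arg (z0 / z0)"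
    using \<open>z0 \<noteq> 0\<close> by (intro continuous_at_Arg) simp
  ultimately have "isCont (\<lambda>z. Arg (z / z0)) z0"
    by (rule isCont_o2)
  then have "isCont (\<lambda>z. t0 + Arg (z / z0) / (2 * pi)) z0"
    by (intro isCont_add continuous_const isCont_divide) simp_all
  then have "isCont (\<lambda>z. \<theta> (t0 + Arg (z / z0) / (2 * pi))) z0"
    by (rule isCont_o2) (rule cont')
  then have "isCont (\<lambda>z. circ (\<theta> (t0 + Arg (z / z0) / (2 * pi)))) z0"
    by (rule isCont_o2) (rule isCont_circ)
  then have "continuous (at z0 within sphere 0 1) (\<lambda>z. circ (\<theta> (t0 + Arg (z / z0) / (2 * pi))))"
    by (rule continuous_at_imp_continuous_at_within)
  then show "continuous (at z0 within sphere 0 1) (circle_map \<theta>)"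
    by (rule continuous_transform_within[where \<delta> = 1]) (use z0 eq in auto)
qed

lemma unit_circle_cases:
  assumes "norm z = 1"
  obtains t where "z = circ t"
  using circ_Arg[OF assms] by metis

section \<open>Winding numbers and the degree\<close>

text \<open>
  In the intended case \<open>exp \<circ> L\<close> is a closed curve that winds \<open>c / (2 \<pi> \<i>)\<close> times around 0, and \<open>\<theta>\<close> is a
  reparametrization of degree \<open>d\<close> that leaves the curve pointwise unchanged. The difference
  \<open>L \<circ> \<theta> - L\<close> takes values in the discrete set \<open>2 \<pi> \<i> \<int>\<close>, so it is constant; but over
  one period its first term grows by \<open>d c\<close> and its second by \<open>c\<close>.
\<close>

lemma degree_eq_1_if_log_preserved:
  fixes L :: "real \<Rightarrow> complex"
  assumes contL: "continuous_on UNIV L" and L_per: "\<And>t. L (t + 1) = L t + c" and "c \<noteq> 0"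
    and cont: "continuous_on UNIV \<theta>" and deg: "\<And>t. \<theta> (t + 1) = \<theta> t + of_int d"
    and fib: "\<And>t. exp (L (\<theta> t)) = exp (L t)"
  shows "d = 1"
proof -
  define D where "D = (\<lambda>t. (L (\<theta> t) - L t) / (2 * pi * \<i>))"
  have "continuous_on UNIV D"
    unfolding D_def using continuous_on_compose2[OF contL cont]
    by (intro continuous_intros contL) auto
  moreover have "D t \<in> \<int>" for t
  proof -
    obtain n :: int where "L (\<theta> t) = L t + (of_int (2 * n) * pi) * \<i>"
      using fib[of t] unfolding exp_eq by blast
    then have "D t = of_int n"
      by (simp add: D_def field_simps)
    then show ?thesis by simp
  qed
  ultimately have "D 1 = D 0"
    by (rule continuous_Ints_imp_constant)
  then have "L (\<theta> 1) - L 1 = L (\<theta> 0) - L 0"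
    by (simp add: D_def)
  moreover have "L 1 = L 0 + c"
    using L_per[of 0] by simp
  moreover have "L (\<theta> 1) = L (\<theta> 0) + of_int d * c"
  proof -
    \<comment> \<open>Subtracting the linear part \<open>t c\<close> from \<open>L\<close> leaves a function of period 1.\<close>
    have "L (\<theta> 0 + of_int d) - of_real (\<theta> 0 + of_int d) * c = L (\<theta> 0) - of_real (\<theta> 0) * c"
      by (rule periodic_add_of_int[where g = "\<lambda>t. L t - of_real t * c"])
        (simp add: L_per algebra_simps)
    moreover have "\<theta> 1 = \<theta> 0 + of_int d"
      using deg[of 0] by simp
    ultimately show ?thesis
      by (simp add: algebra_simps)
  qed
  ultimately have "of_int d * c = c" by simp
  with \<open>c \<noteq> 0\<close> show "d = 1" by simp
qed

text \<open>
  By the argument principle the winding number is the number of zeros of \<open>\<phi> - \<phi> z0\<close> in the unit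
  disc, counted with multiplicity, and \<open>z0\<close> is one of them.
\<close>

lemma winding_number_holomorphic_image_nonzero:
  assumes "1 < r" and holo: "\<phi> holomorphic_on ball 0 r" and nonconst: "\<not> \<phi> constant_on ball 0 r"
    and z0: "norm z0 < 1" and avoid: "\<phi> z0 \<notin> \<phi> ` sphere 0 1"
  shows "winding_number (\<phi> \<circ> circlepath 0 1) (\<phi> z0) \<noteq> 0"
proof -
  define w where "w = \<phi> z0"
  define g where "g = (\<lambda>z. \<phi> z - w)"
  \<comment> \<open>The zeros are counted in a smaller disc, whose closure is compact, so that they are finitely many.\<close>
  obtain s where s: "1 < s" "s < r"
    using dense \<open>1 < r\<close> by blast
  have g_holo: "g holomorphic_on ball 0 r"
    unfolding g_def by (intro holomorphic_intros holo)
  then have g_holo': "g holomorphic_on ball 0 s"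
    using s by (auto intro: holomorphic_on_subset)
  have g_nonconst: "\<not> g constant_on ball 0 r"
  proof
    assume "g constant_on ball 0 r"
    then obtain c where "\<And>z. z \<in> ball 0 r \<Longrightarrow> \<phi> z - w = c"
      by (auto simp: g_def constant_on_def)
    then have "\<phi> constant_on ball 0 r"
      unfolding constant_on_def by (intro exI[of _ "c + w"]) (auto simp: algebra_simps)
    with nonconst show False ..
  qed
  define Z where "Z = {p \<in> ball 0 s. g p = 0}"
  have "finite {z \<in> cball 0 s. g z = 0}"
    using s by (intro holomorphic_compact_finite_zeros[OF g_holo _ _ _ _ g_nonconst]) auto
  then have finZ: "finite Z"
    by (rule finite_subset[rotated]) (auto simp: Z_def)
  have g_sphere: "g z \<noteq> 0" if "norm z = 1" for z
  proof -
    from that have "\<phi> z \<in> \<phi> ` sphere 0 1" by simp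
    with avoid show ?thesis by (auto simp: g_def w_def)
  qed
  have order_pos: "0 < zorder g p" if "p \<in> Z" for p
  proof -
    obtain b where "b \<in> ball 0 r" "g b \<noteq> 0"
      using g_nonconst unfolding constant_on_def by blast
    moreover have "p \<in> ball 0 r"
      using that s by (auto simp: Z_def)
    ultimately have "\<forall>\<^sub>F w in at p. g w \<noteq> 0 \<and> w \<in> ball 0 r"
      by (intro non_zero_neighbour_alt[OF g_holo]) auto
    then have "\<exists>\<^sub>F w in at p. g w \<noteq> 0"
      by (intro eventually_frequently) (auto elim: eventually_mono)
    then show ?thesis
      using zorder_pos_iff[OF g_holo] \<open>p \<in> ball 0 r\<close> that by (auto simp: Z_def)
  qed
  have winding: "winding_number (circlepath 0 1) p = (if norm p < 1 then 1 else 0)" if "p \<in> Z" for p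
  proof (cases "norm p < 1")
    case False
    moreover have "norm p \<noteq> 1"
      using that g_sphere by (auto simp: Z_def)
    ultimately show ?thesis
      by (auto intro!: winding_number_zero_outside[of _ "cball 0 1"])
  qed (simp add: winding_number_circlepath)
  have path_holo: "valid_path (\<phi> \<circ> circlepath 0 1)"
    using s by (intro valid_path_compose_holomorphic[OF _ holo]) auto
  have "2 * pi * \<i> * winding_number (\<phi> \<circ> circlepath 0 1) w
      = contour_integral (\<phi> \<circ> circlepath 0 1) (\<lambda>u. 1 / (u - w))"
    using avoid by (subst winding_number_valid_path[OF path_holo]) (auto simp: path_image_compose w_def)
  also have "\<dots> = contour_integral (circlepath 0 1) (\<lambda>z. deriv \<phi> z * (1 / (\<phi> z - w)))"
    using s holo by (intro contour_integral_comp_analyticW[where s = "ball 0 r"]) (auto simp: analytic_on_open)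
  also have "\<dots> = contour_integral (circlepath 0 1) (\<lambda>z. deriv g z * 1 / g z)"
  proof (rule contour_integral_eq)
    fix z :: complex assume "z \<in> path_image (circlepath 0 1)"
    then have "\<phi> field_differentiable at z"
      using s holomorphic_on_imp_differentiable_at[OF holo] by auto
    then show "deriv \<phi> z * (1 / (\<phi> z - w)) = deriv g z * 1 / g z"
      by (simp add: g_def)
  qed
  also have "\<dots> = 2 * pi * \<i> * (\<Sum>p\<in>Z. winding_number (circlepath 0 1) p * 1 * zorder g p)"
  proof -
    have Z: "{p \<in> ball 0 s. g p = 0 \<or> p \<in> {}} = Z"
      by (simp add: Z_def)
    show ?thesis
    proof (rule argument_principle[where poles = "{}" and S = "ball 0 s" and h = "\<lambda>_. 1" and f = g, unfolded Z])
      show "path_image (circlepath 0 1) \<subseteq> ball 0 s - Z"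
        using s g_sphere by (auto simp: Z_def)
      show "\<forall>z. z \<notin> ball 0 s \<longrightarrow> winding_number (circlepath 0 1) z = 0"
        using s by (auto intro!: winding_number_zero_outside[of _ "cball 0 1"])
    qed (use g_holo' finZ in auto)
  qed
  finally have "winding_number (\<phi> \<circ> circlepath 0 1) w
      = (\<Sum>p\<in>Z. winding_number (circlepath 0 1) p * zorder g p)"
    by simp
  also have "\<dots> = of_int (\<Sum>p\<in>Z. if norm p < 1 then zorder g p else 0)"
    unfolding of_int_sum by (intro sum.cong refl) (simp add: winding)
  also have "\<dots> \<noteq> 0"
  proof -
    have "z0 \<in> Z"
      using z0 s by (auto simp: Z_def g_def w_def)
    then have "0 < (\<Sum>p\<in>Z. if norm p < 1 then zorder g p else 0)"
      using finZ order_pos z0 by (intro sum_pos2[of Z z0]) (auto simp: less_imp_le)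
    then show ?thesis
      by (simp only: of_int_eq_0_iff less_imp_neq[symmetric] not_False_eq_True)
  qed
  finally show ?thesis
    by (simp add: w_def)
qed

text \<open>
  The image of the circle under a differentiable map is a null set, whereas the image of the disc is
  open.
\<close>

lemma holomorphic_disc_image_not_subset_circle_image:
  assumes "1 < r" and holo: "\<phi> holomorphic_on ball 0 r" and nonconst: "\<not> \<phi> constant_on ball 0 r"
  obtains z0 where "norm z0 < 1" "\<phi> z0 \<notin> \<phi> ` sphere 0 1"
proof -
  have "\<phi> field_differentiable at z" if "z \<in> sphere 0 1" for z
    using that \<open>1 < r\<close> holomorphic_on_imp_differentiable_at[OF holo] by auto
  then have "\<phi> differentiable_on sphere 0 1"
    unfolding differentiable_on_def
    by (metis differentiable_at_withinI field_differentiable_imp_differentiable)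
  then have "negligible (\<phi> ` sphere 0 1)"
    by (intro negligible_differentiable_image_negligible negligible_sphere) auto
  moreover have "open (\<phi> ` ball 0 1)"
    using assms by (intro open_mapping_thm[OF holo]) auto
  then have "\<not> negligible (\<phi> ` ball 0 1)"
    by (rule open_not_negligible) auto
  ultimately have "\<not> \<phi> ` ball 0 1 \<subseteq> \<phi> ` sphere 0 1"
    using negligible_subset by blast
  then obtain z0 where "z0 \<in> ball 0 1" "\<phi> z0 \<notin> \<phi> ` sphere 0 1"
    by blast
  then show ?thesis
    by (intro that) simp_all
qed

lemma analytic_on_cball_imp_holomorphic_on_larger_ball:
  assumes "\<phi> analytic_on cball 0 1"
  obtains r :: real where "1 < r" "\<phi> holomorphic_on ball 0 r"
proof -
  obtain U where U: "open U" "cball 0 1 \<subseteq> U" "\<phi> holomorphic_on U"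
    using assms unfolding analytic_on_holomorphic by blast
  obtain e where e: "0 < e" "(\<Union>x\<in>cball 0 1. ball x e) \<subseteq> U"
    using compact_subset_open_imp_ball_epsilon_subset[OF compact_cball U(1,2)] by blast
  have "ball 0 (1 + e) \<subseteq> U"
  proof
    fix z :: complex assume z: "z \<in> ball 0 (1 + e)"
    show "z \<in> U"
    proof (cases "norm z \<le> 1")
      case False
      \<comment> \<open>The ball of radius \<open>e\<close> that contains \<open>z\<close> is centred at its radial projection.\<close>
      define x where "x = z / of_real (norm z)"
      from False have "z \<noteq> 0" by auto
      then have "z - x = x * of_real (norm z) - x"
        by (simp add: x_def)
      also have "\<dots> = x * of_real (norm z - 1)"
        by (simp add: algebra_simps)
      finally have "norm (z - x) = norm x * \<bar>norm z - 1\<bar>"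
        by (simp only: norm_mult norm_of_real)
      moreover have "norm x = 1"
        using False by (auto simp: x_def norm_divide)
      ultimately have "z \<in> ball x e" "x \<in> cball 0 1"
        using z False by (auto simp: dist_norm norm_minus_commute)
      then show ?thesis
        using e(2) by blast
    qed (use U(2) in auto)
  qed
  then show ?thesis
    using that[of "1 + e"] e(1) U(3) holomorphic_on_subset by auto
qed

text \<open>
  The fibres on the circle are the zeros, in a compact set, of a nonconstant holomorphic function.
\<close>

lemma finite_fibre_periodic_circ:
  assumes "1 < r" and holo: "\<phi> holomorphic_on ball 0 r" and nonconst: "\<not> \<phi> constant_on ball 0 r"
  shows "finite_fibre_periodic (\<lambda>t. \<phi> (circ t))"
proof
  show "\<phi> (circ (t + 1)) = \<phi> (circ t)" for t
    by simp
  show "finite {t \<in> {0..<1}. \<phi> (circ t) = c}" for c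
  proof (rule finite_imageD)
    have "\<not> (\<lambda>z. \<phi> z - c) constant_on ball 0 r"
    proof
      assume "(\<lambda>z. \<phi> z - c) constant_on ball 0 r"
      then obtain b where "\<And>z. z \<in> ball 0 r \<Longrightarrow> \<phi> z - c = b"
        unfolding constant_on_def by blast
      then have "\<phi> constant_on ball 0 r"
        unfolding constant_on_def by (intro exI[of _ "b + c"]) (auto simp: algebra_simps)
      with nonconst show False ..
    qed
    then have "finite {z \<in> sphere 0 1. \<phi> z - c = 0}"
      using \<open>1 < r\<close>
      by (intro holomorphic_compact_finite_zeros[of "\<lambda>z. \<phi> z - c" "ball 0 r"] holomorphic_intros holo) auto
    then show "finite (circ ` {t \<in> {0..<1}. \<phi> (circ t) = c})"
      by (rule finite_subset[rotated]) auto
    show "inj_on circ {t \<in> {0..<1}. \<phi> (circ t) = c}"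
    proof (rule inj_onI)
      fix s t assume st: "s \<in> {t \<in> {0..<1}. \<phi> (circ t) = c}" "t \<in> {t \<in> {0..<1}. \<phi> (circ t) = c}"
        and "circ s = circ t"
      then obtain k where "s - t = of_int k"
        by (auto simp: circ_eq_iff elim: Ints_cases)
      moreover from this st have "- 1 < (of_int k :: real)" "(of_int k :: real) < 1"
        by auto
      then have "k = 0" by linarith
      ultimately show "s = t" by simp
    qed
  qed
qed

text \<open>
  The hypothesis on \<open>\<theta> (t + 1) - \<theta> t\<close> says that \<open>\<theta>\<close> lifts a self-map of the circle. Its degree is
  computed with a logarithm of \<open>\<phi> \<circ> circ - \<phi> z0\<close>, where \<open>z0\<close> is a point of the disc whose value
  is not taken on the circle; the increment of the logarithm over a period is \<open>2 \<pi> \<i>\<close> times the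
  winding number around \<open>\<phi> z0\<close>.
\<close>

lemma fibre_preserving_lift_add_1:
  assumes "1 < r" and holo: "\<phi> holomorphic_on ball 0 r" and nonconst: "\<not> \<phi> constant_on ball 0 r"
    and cont: "continuous_on UNIV \<theta>" and fib: "\<And>t. \<phi> (circ (\<theta> t)) = \<phi> (circ t)"
    and ints: "\<And>t. \<theta> (t + 1) - \<theta> t \<in> \<int>"
  shows "\<theta> (t + 1) = \<theta> t + 1"
proof -
  have "continuous_on UNIV (\<lambda>t. \<theta> (t + 1) - \<theta> t)"
    by (intro continuous_on_diff cont continuous_on_compose2[OF cont] continuous_on_add
        continuous_on_id continuous_on_const) auto
  then have const: "\<theta> (t + 1) - \<theta> t = \<theta> (0 + 1) - \<theta> 0" for t
    using ints by (rule continuous_Ints_imp_constant)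
  obtain d where "\<theta> (0 + 1) - \<theta> 0 = of_int d"
    using ints Ints_cases by metis
  then have deg: "\<theta> (t + 1) = \<theta> t + of_int d" for t
    using const[of t] by simp
  obtain z0 where z0: "norm z0 < 1" "\<phi> z0 \<notin> \<phi> ` sphere 0 1"
    by (rule holomorphic_disc_image_not_subset_circle_image[OF assms(1-3)])
  have "sphere 0 1 \<subseteq> ball (0::complex) r"
    using \<open>1 < r\<close> by auto
  then have \<phi>_cont: "continuous_on (sphere 0 1) \<phi>"
    by (rule continuous_on_subset[OF holomorphic_on_imp_continuous_on[OF holo]])
  have "continuous_on UNIV (\<lambda>t. \<phi> (circ t) - \<phi> z0)"
    by (intro continuous_on_diff continuous_on_const continuous_on_compose2[OF \<phi>_cont]
        continuous_on_circ continuous_on_id) auto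
  moreover have "\<phi> (circ t) - \<phi> z0 \<noteq> 0" for t
  proof -
    have "\<phi> (circ t) \<in> \<phi> ` sphere 0 1" by simp
    with z0(2) have "\<phi> (circ t) \<noteq> \<phi> z0" by metis
    then show ?thesis by simp
  qed
  ultimately obtain L where L: "continuous_on UNIV L" "\<And>t. \<phi> (circ t) - \<phi> z0 = exp (L t)"
    using continuous_logarithm_on_contractible[of UNIV "\<lambda>t. \<phi> (circ t) - \<phi> z0"] by auto
  have "(L (t + 1) - L t) / (2 * pi * \<i>) \<in> \<int>" for t
  proof -
    have "exp (L (t + 1)) = exp (L t)"
      by (simp flip: L(2))
    then obtain n :: int where "L (t + 1) = L t + (of_int (2 * n) * pi) * \<i>"
      unfolding exp_eq by blast
    then have "(L (t + 1) - L t) / (2 * pi * \<i>) = of_int n"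
      by (simp add: field_simps)
    then show ?thesis by simp
  qed
  moreover have "continuous_on UNIV (\<lambda>t. (L (t + 1) - L t) / (2 * pi * \<i>))"
    by (intro continuous_on_divide continuous_on_diff L(1) continuous_on_compose2[OF L(1)]
        continuous_on_add continuous_on_id continuous_on_const) auto
  ultimately have "(L (t + 1) - L t) / (2 * pi * \<i>) = (L (0 + 1) - L 0) / (2 * pi * \<i>)" for t
    by (rule continuous_Ints_imp_constant[rotated])
  then have "L (t + 1) - L t = L 1 - L 0" for t
    by simp
  then have L_per: "L (t + 1) = L t + (L 1 - L 0)" for t
    by (metis add.commute diff_add_cancel)
  have "winding_number (\<phi> \<circ> circlepath 0 1) (\<phi> z0) = winding_number (exp \<circ> L) 0"
    unfolding winding_number_offset[of _ "\<phi> z0"]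
    by (rule winding_number_cong) (simp add: circlepath_eq_circ L(2))
  also have "\<dots> = (L 1 - L 0) / (2 * pi * \<i>)"
    using winding_number_compose_exp[of L] continuous_on_subset[OF L(1)]
    by (simp add: path_def pathstart_def pathfinish_def)
  finally have "L 1 - L 0 \<noteq> 0"
    using winding_number_holomorphic_image_nonzero[OF assms(1-3) z0] by auto
  moreover have "exp (L (\<theta> t)) = exp (L t)" for t
    by (simp add: fib flip: L(2))
  ultimately have "d = 1"
    by (rule degree_eq_1_if_log_preserved[OF L(1) L_per _ cont deg])
  then show ?thesis
    using deg by simp
qed

section \<open>The group\<close>

lemma (in monoid) finite_cyclic_group_if_powers:
  assumes g: "g \<in> carrier G" and "0 < N" and gN: "g [^] (N::nat) = \<one>"
    and powers: "\<And>x. x \<in> carrier G \<Longrightarrow> \<exists>k::nat. x = g [^] k"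
  shows "group G \<and> finite (carrier G) \<and> cyclic_group G"
proof -
  have mult_N: "g [^] (N * k) = \<one>" for k :: nat
    by (metis nat_pow_pow[OF g] nat_pow_one gN)
  have "x \<in> Units G" if xG: "x \<in> carrier G" for x
  proof -
    obtain k :: nat where x: "x = g [^] k"
      using powers[OF xG] by blast
    have e: "k * (N - 1) + k = N * k" "k + k * (N - 1) = N * k"
      using \<open>0 < N\<close> by (auto simp: gr0_conv_Suc)
    then have "g [^] (k * (N - 1)) \<otimes> x = \<one>" "x \<otimes> g [^] (k * (N - 1)) = \<one>"
      by (simp_all only: x nat_pow_mult[OF g] e mult_N)
    then show ?thesis
      using xG nat_pow_closed[OF g, of "k * (N - 1)"] unfolding Units_def by blast
  qed
  then have group: "group G"
    by unfold_locales auto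
  interpret group G by (rule group)
  have "carrier G \<subseteq> (\<lambda>k. g [^] k) ` {..<N}"
  proof
    fix x assume "x \<in> carrier G"
    then obtain k :: nat where "x = g [^] k"
      using powers by blast
    also have "\<dots> = g [^] (N * (k div N) + k mod N)" by simp
    also have "\<dots> = g [^] (k mod N)"
      using g nat_pow_mult[OF g, of "N * (k div N)" "k mod N"] mult_N[of "k div N"] by simp
    finally show "x \<in> (\<lambda>k. g [^] k) ` {..<N}"
      using \<open>0 < N\<close> by auto
  qed
  then have "finite (carrier G)"
    by (rule finite_subset) simp
  moreover have "carrier G = range (\<lambda>n::int. g [^] n)"
    using powers g by (auto simp flip: int_pow_int)
  then have "cyclic_group G"
    using g cyclic_group by blast
  ultimately show ?thesis
    using group by blast
qed

theorem theorem1p4: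
  fixes \<phi> :: "complex \<Rightarrow> complex"
  assumes "\<phi> analytic_on cball 0 1"
    and "\<not> \<phi> constant_on cball 0 1"
  shows "group (G_phi \<phi>) \<and> finite (carrier (G_phi \<phi>)) \<and> cyclic_group (G_phi \<phi>)"
proof -
  obtain r where r: "1 < r" and holo: "\<phi> holomorphic_on ball 0 r"
    using analytic_on_cball_imp_holomorphic_on_larger_ball[OF assms(1)] by blast
  have "cball 0 1 \<subseteq> ball (0::complex) r"
    using r by auto
  then have nonconst: "\<not> \<phi> constant_on ball 0 r"
    using assms(2) constant_on_subset[of \<phi> "ball 0 r" "cball 0 1"] by blast
  interpret finite_fibre_periodic "\<lambda>t. \<phi> (circ t)"
    by (rule finite_fibre_periodic_circ[OF r holo nonconst])
  interpret monoid "G_phi \<phi>" by (rule monoid_G_phi)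
  have map_circ: "circle_map \<theta> (circ t) = circ (\<theta> t)" if "\<theta> \<in> deck_lifts" for \<theta> t
    using circle_map_circ deck_lift_add_of_int[OF that] by blast
  have in_G: "circle_map \<theta> \<in> carrier (G_phi \<phi>)" if \<theta>: "\<theta> \<in> deck_lifts" for \<theta>
  proof -
    have "circle_map \<theta> \<in> sphere 0 1 \<rightarrow>\<^sub>E sphere 0 1"
      by (auto simp: circle_map_def)
    moreover have "continuous_on (sphere 0 1) (circle_map \<theta>)"
      using \<theta> by (intro continuous_on_circle_map deck_lift_continuous deck_lift_add_of_int)
    moreover have "\<phi> (circle_map \<theta> z) = \<phi> z" if "z \<in> sphere 0 1" for z
      using that deck_lift_fibre[OF \<theta>] by (auto simp: map_circ[OF \<theta>] elim!: unit_circle_cases)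
    ultimately show ?thesis
      by (simp add: G_phi_def)
  qed
  have comp: "circle_map (\<theta> \<circ> \<eta>) = circle_map \<theta> \<otimes>\<^bsub>G_phi \<phi>\<^esub> circle_map \<eta>"
    if "\<theta> \<in> deck_lifts" "\<eta> \<in> deck_lifts" for \<theta> \<eta>
  proof -
    have "circle_map (\<theta> \<circ> \<eta>) z = compose (sphere 0 1) (circle_map \<theta>) (circle_map \<eta>) z" for z
    proof (cases "norm z = 1")
      case True
      then obtain t where "z = circ t" by (rule unit_circle_cases)
      then show ?thesis
        using that by (simp add: compose_def map_circ deck_lift_comp)
    qed (simp add: circle_map_def compose_def)
    then show ?thesis
      by (auto simp: G_phi_def)
  qed
  have shift: "circle_map (\<lambda>t. t + of_int k) = \<one>\<^bsub>G_phi \<phi>\<^esub>" for k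
  proof -
    have "circle_map (\<lambda>t. t + of_int k) z = (\<lambda>z\<in>sphere 0 1. z) z" for z
    proof (cases "norm z = 1")
      case True
      then obtain t where "z = circ t" by (rule unit_circle_cases)
      then show ?thesis
        by (simp add: map_circ[OF deck_lift_shift]) (simp add: circ_eq_iff)
    qed (simp add: circle_map_def)
    then show ?thesis
      by (auto simp: G_phi_def)
  qed
  obtain \<tau> where \<tau>: "\<tau> \<in> deck_lifts"
    and powers: "\<And>\<sigma>. \<sigma> \<in> deck_lifts \<Longrightarrow> 0 \<le> \<sigma> 0 \<Longrightarrow> \<exists>k. \<sigma> = \<tau> ^^ k"
    using deck_lifts_cyclic by blast
  have power: "\<tau> ^^ k \<in> deck_lifts \<and> circle_map (\<tau> ^^ k) = circle_map \<tau> [^]\<^bsub>G_phi \<phi>\<^esub> k" for k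
  proof (induction k)
    case 0
    then show ?case
      using deck_lift_shift[of 0] shift[of 0] by (simp add: id_def)
  next
    case (Suc k)
    then show ?case
      using comp[OF _ \<tau>, of "\<tau> ^^ k"] deck_lift_comp[OF _ \<tau>, of "\<tau> ^^ k"]
      by (simp only: funpow_Suc_right nat_pow_Suc simp_thms)
  qed
  \<comment> \<open>The unit shift descends to the identity, which makes the order of the generator finite.\<close>
  have "\<exists>N. (\<lambda>t. t + of_int 1) = \<tau> ^^ N"
    by (rule powers[OF deck_lift_shift]) simp
  then obtain N where N: "(\<lambda>t. t + of_int 1) = \<tau> ^^ N" ..
  have "0 < N"
  proof (rule ccontr)
    assume "\<not> 0 < N"
    with fun_cong[OF N, of 0] show False by simp
  qed
  moreover have "circle_map \<tau> [^]\<^bsub>G_phi \<phi>\<^esub> N = \<one>\<^bsub>G_phi \<phi>\<^esub>"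
    using power[of N] shift[of 1] N by simp
  moreover have "\<exists>k::nat. \<rho> = circle_map \<tau> [^]\<^bsub>G_phi \<phi>\<^esub> k" if \<rho>: "\<rho> \<in> carrier (G_phi \<phi>)" for \<rho>
  proof -
    have \<rho>_maps: "\<rho> \<in> sphere 0 1 \<rightarrow>\<^sub>E sphere 0 1" and \<rho>_cont: "continuous_on (sphere 0 1) \<rho>"
      and \<rho>_fib: "\<forall>z\<in>sphere 0 1. \<phi> (\<rho> z) = \<phi> z"
      using \<rho> by (simp_all add: G_phi_def)
    have cont: "continuous_on UNIV (\<lambda>t. \<rho> (circ t))"
      by (intro continuous_on_compose2[OF \<rho>_cont] continuous_on_circ continuous_on_id) auto
    have norm: "norm (\<rho> (circ t)) = 1" for t
      using PiE_mem[OF \<rho>_maps, of "circ t"] by simp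
    obtain \<theta> where \<theta>: "continuous_on UNIV \<theta>" "\<And>t. \<rho> (circ t) = circ (\<theta> t)"
      using circ_continuous_lift[OF cont norm] by metis
    have fib: "\<phi> (circ (\<theta> t)) = \<phi> (circ t)" for t
      using bspec[OF \<rho>_fib, of "circ t"] by (simp add: \<theta>(2))
    have "circ (\<theta> (t + 1)) = circ (\<theta> t)" for t
      using \<theta>(2)[of "t + 1"] \<theta>(2)[of t] by simp
    then have "\<theta> (t + 1) = \<theta> t + 1" for t
      by (intro fibre_preserving_lift_add_1[OF r holo nonconst \<theta>(1) fib]) (simp flip: circ_eq_iff)
    then have \<theta>_deck: "\<theta> \<in> deck_lifts"
      using \<theta>(1) fib by (simp add: deck_lifts_def)
    \<comment> \<open>An integer translate of \<open>\<theta>\<close> with value at 0 in \<open>[0, 1)\<close>; it is a lift of the same map.\<close>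
    define \<sigma> where "\<sigma> = (\<lambda>t. t + of_int (- \<lfloor>\<theta> 0\<rfloor>)) \<circ> \<theta>"
    have "\<sigma> \<in> deck_lifts"
      unfolding \<sigma>_def by (intro deck_lift_comp deck_lift_shift \<theta>_deck)
    moreover have "0 \<le> \<sigma> 0"
      by (simp add: \<sigma>_def)
    ultimately obtain k where "\<sigma> = \<tau> ^^ k"
      using powers by blast
    moreover have "circle_map \<sigma> = \<rho>"
    proof
      fix z
      show "circle_map \<sigma> z = \<rho> z"
      proof (cases "norm z = 1")
        case True
        then obtain t where "z = circ t" by (rule unit_circle_cases)
        then show ?thesis
          by (simp add: map_circ[OF \<open>\<sigma> \<in> deck_lifts\<close>] \<theta>(2)) (simp add: \<sigma>_def circ_eq_iff)
      qed (simp add: circle_map_def PiE_arb[OF \<rho>_maps])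
    qed
    ultimately show ?thesis
      using power by metis
  qed
  ultimately show ?thesis
    using finite_cyclic_group_if_powers[OF in_G[OF \<tau>]] by blast
qed

end
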